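(* Let $A \supseteq B$ be a Frobenius extension of rings with Frobenius homomorphism $E : A \to B$ and dual bases $x_i, y_i \in A$ ($i=1,\dots,n$), such that the element $[A:B]_E := \sum_i x_i y_i$ is invertible in the center $Z(A)$. Then $Z(A) = A^B$ if and only if $[A:B]_E^{-1} \sum_i x_i \otimes_B y_i$ is the unique separability element of $A \supseteq B$.
   Context: Rings are unital and associative, not necessarily commutative; $B$ is a subring of $A$ with $1_B = 1_A$. $A^B = \{a \in A : ab = ba \text{ for all } b \in B\}$ is the centralizer of $B$ in $A$. $A \supseteq B$ is a Frobenius extension if there is a $B$-$B$-bimodule homomorphism $E : A \to B$ (a Frobenius homomorphism) and elements (dual bases) $x_1,\dots,x_n,y_1,\dots,y_n \in A$ such that $a = \sum_{i} E(a x_i) y_i = \sum_{i} x_i E(y_i a)$ for all $a \in A$. The element $\sum_i x_i y_i$ always lies in $Z(A)$ and is called the $E$-index. A separability element of $A \supseteq B$ is an element $e = e^1 \otimes_B e^2 \in A \otimes_B A$ (summation suppressed) with $ae = ea$ for all $a \in A$ and $e^1 e^2 = 1$. *)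

theory Defs
  imports "HOL-Algebra.Algebra"
begin

section \<open>Center and centralizer\<close>

definition ring_center :: "('a, 'm) ring_scheme \<Rightarrow> 'a set"
  where "ring_center A = {z \<in> carrier A. \<forall>a \<in> carrier A. z \<otimes>\<^bsub>A\<^esub> a = a \<otimes>\<^bsub>A\<^esub> z}"

definition ring_centralizer :: "('a, 'm) ring_scheme \<Rightarrow> 'a set \<Rightarrow> 'a set"
  where "ring_centralizer A B = {a \<in> carrier A. \<forall>b \<in> B. a \<otimes>\<^bsub>A\<^esub> b = b \<otimes>\<^bsub>A\<^esub> a}"


section \<open>Frobenius extensions\<close>

definition bimodule_hom :: "('a, 'm) ring_scheme \<Rightarrow> 'a set \<Rightarrow> ('a \<Rightarrow> 'a) \<Rightarrow> bool"
  where "bimodule_hom A B E \<longleftrightarrow>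
    E \<in> carrier A \<rightarrow> B \<and>
    (\<forall>a \<in> carrier A. \<forall>a' \<in> carrier A. E (a \<oplus>\<^bsub>A\<^esub> a') = E a \<oplus>\<^bsub>A\<^esub> E a') \<and>
    (\<forall>b \<in> B. \<forall>a \<in> carrier A. E (b \<otimes>\<^bsub>A\<^esub> a) = b \<otimes>\<^bsub>A\<^esub> E a) \<and>
    (\<forall>a \<in> carrier A. \<forall>b \<in> B. E (a \<otimes>\<^bsub>A\<^esub> b) = E a \<otimes>\<^bsub>A\<^esub> b)"

definition dual_bases ::
    "('a, 'm) ring_scheme \<Rightarrow> ('a \<Rightarrow> 'a) \<Rightarrow> nat \<Rightarrow> (nat \<Rightarrow> 'a) \<Rightarrow> (nat \<Rightarrow> 'a) \<Rightarrow> bool"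
  where "dual_bases A E n x y \<longleftrightarrow>
    x \<in> {1..n} \<rightarrow> carrier A \<and> y \<in> {1..n} \<rightarrow> carrier A \<and>
    (\<forall>a \<in> carrier A.
       a = (\<Oplus>\<^bsub>A\<^esub>i\<in>{1..n}. E (a \<otimes>\<^bsub>A\<^esub> x i) \<otimes>\<^bsub>A\<^esub> y i) \<and>
       a = (\<Oplus>\<^bsub>A\<^esub>i\<in>{1..n}. x i \<otimes>\<^bsub>A\<^esub> E (y i \<otimes>\<^bsub>A\<^esub> a)))"

definition frobenius_extension :: "('a, 'm) ring_scheme \<Rightarrow> 'a set \<Rightarrow> ('a \<Rightarrow> 'a) \<Rightarrow> bool"
  where "frobenius_extension A B E \<longleftrightarrow>
    ring A \<and> subring B A \<and> bimodule_hom A B E \<and> (\<exists>n x y. dual_bases A E n x y)"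

definition frobenius_index ::
    "('a, 'm) ring_scheme \<Rightarrow> nat \<Rightarrow> (nat \<Rightarrow> 'a) \<Rightarrow> (nat \<Rightarrow> 'a) \<Rightarrow> 'a"
  where "frobenius_index A n x y = (\<Oplus>\<^bsub>A\<^esub>i\<in>{1..n}. x i \<otimes>\<^bsub>A\<^esub> y i)"


section \<open>The tensor product of A with itself over B\<close>

text \<open>
  The tensor product is the free abelian group on pairs of elements of the ring, modulo the
  usual relations; its elements are cosets. Following the library, the abelian groups here are
  multiplicatively written monoid records, so sums of tensors are products in
  \<open>tensor_group A B\<close>.
\<close>

definition tensor_relations ::
    "('a, 'm) ring_scheme \<Rightarrow> 'a set \<Rightarrow> ('a \<times> 'a \<Rightarrow>\<^sub>0 int) set"
  where "tensor_relations A B =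
    {frag_of (x \<oplus>\<^bsub>A\<^esub> x', y) - frag_of (x, y) - frag_of (x', y) | x x' y.
       x \<in> carrier A \<and> x' \<in> carrier A \<and> y \<in> carrier A} \<union>
    {frag_of (x, y \<oplus>\<^bsub>A\<^esub> y') - frag_of (x, y) - frag_of (x, y') | x y y'.
       x \<in> carrier A \<and> y \<in> carrier A \<and> y' \<in> carrier A} \<union>
    {frag_of (x \<otimes>\<^bsub>A\<^esub> b, y) - frag_of (x, b \<otimes>\<^bsub>A\<^esub> y) | x b y.
       x \<in> carrier A \<and> b \<in> B \<and> y \<in> carrier A}"

abbreviation pairs_group :: "('a, 'm) ring_scheme \<Rightarrow> ('a \<times> 'a \<Rightarrow>\<^sub>0 int) monoid"
  where "pairs_group A \<equiv> free_Abelian_group (carrier A \<times> carrier A)"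

definition tensor_kernel ::
    "('a, 'm) ring_scheme \<Rightarrow> 'a set \<Rightarrow> ('a \<times> 'a \<Rightarrow>\<^sub>0 int) set"
  where "tensor_kernel A B = generate (pairs_group A) (tensor_relations A B)"

definition tensor_group ::
    "('a, 'm) ring_scheme \<Rightarrow> 'a set \<Rightarrow> (('a \<times> 'a \<Rightarrow>\<^sub>0 int) set) monoid"
  where "tensor_group A B = pairs_group A Mod tensor_kernel A B"

definition pure_tensor ::
    "('a, 'm) ring_scheme \<Rightarrow> 'a set \<Rightarrow> 'a \<Rightarrow> 'a \<Rightarrow> ('a \<times> 'a \<Rightarrow>\<^sub>0 int) set"
  where "pure_tensor A B x y = tensor_kernel A B #>\<^bsub>pairs_group A\<^esub> frag_of (x, y)"

definition balanced_map ::
    "('a, 'm) ring_scheme \<Rightarrow> 'a set \<Rightarrow> ('c, 'k) monoid_scheme \<Rightarrow> ('a \<Rightarrow> 'a \<Rightarrow> 'c) \<Rightarrow> bool"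
  where "balanced_map A B G f \<longleftrightarrow>
    (\<forall>x \<in> carrier A. \<forall>y \<in> carrier A. f x y \<in> carrier G) \<and>
    (\<forall>x \<in> carrier A. \<forall>x' \<in> carrier A. \<forall>y \<in> carrier A.
       f (x \<oplus>\<^bsub>A\<^esub> x') y = f x y \<otimes>\<^bsub>G\<^esub> f x' y) \<and>
    (\<forall>x \<in> carrier A. \<forall>y \<in> carrier A. \<forall>y' \<in> carrier A.
       f x (y \<oplus>\<^bsub>A\<^esub> y') = f x y \<otimes>\<^bsub>G\<^esub> f x y') \<and>
    (\<forall>x \<in> carrier A. \<forall>b \<in> B. \<forall>y \<in> carrier A. f (x \<otimes>\<^bsub>A\<^esub> b) y = f x (b \<otimes>\<^bsub>A\<^esub> y))"

definition pairs_lift ::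
    "('c, 'k) monoid_scheme \<Rightarrow> ('a \<Rightarrow> 'a \<Rightarrow> 'c) \<Rightarrow> ('a \<times> 'a \<Rightarrow>\<^sub>0 int) \<Rightarrow> 'c"
  where "pairs_lift G f c =
    (\<Otimes>\<^bsub>G\<^esub>p\<in>Poly_Mapping.keys c. f (fst p) (snd p) [^]\<^bsub>G\<^esub> Poly_Mapping.lookup c p)"

text \<open>
  The homomorphism on the tensor product induced by a balanced map \<open>f\<close> into an abelian group.
  The set under \<open>the_elem\<close> is a singleton as soon as \<open>f\<close> is balanced; this and the
  characterizing properties are \<open>tensor_lift_hom\<close> and \<open>tensor_lift_pure\<close> below.
\<close>

definition tensor_lift ::
    "('c, 'k) monoid_scheme \<Rightarrow> ('a \<Rightarrow> 'a \<Rightarrow> 'c) \<Rightarrow> ('a \<times> 'a \<Rightarrow>\<^sub>0 int) set \<Rightarrow> 'c"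
  where "tensor_lift G f t =
    the_elem (pairs_lift G f ` t)"

definition tensor_lmult ::
    "('a, 'm) ring_scheme \<Rightarrow> 'a set \<Rightarrow> 'a \<Rightarrow> ('a \<times> 'a \<Rightarrow>\<^sub>0 int) set \<Rightarrow> ('a \<times> 'a \<Rightarrow>\<^sub>0 int) set"
  where "tensor_lmult A B a =
    tensor_lift (tensor_group A B) (\<lambda>x y. pure_tensor A B (a \<otimes>\<^bsub>A\<^esub> x) y)"

definition tensor_rmult ::
    "('a, 'm) ring_scheme \<Rightarrow> 'a set \<Rightarrow> ('a \<times> 'a \<Rightarrow>\<^sub>0 int) set \<Rightarrow> 'a \<Rightarrow> ('a \<times> 'a \<Rightarrow>\<^sub>0 int) set"
  where "tensor_rmult A B t a =
    tensor_lift (tensor_group A B) (\<lambda>x y. pure_tensor A B x (y \<otimes>\<^bsub>A\<^esub> a)) t"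

definition tensor_mult_map :: "('a, 'm) ring_scheme \<Rightarrow> ('a \<times> 'a \<Rightarrow>\<^sub>0 int) set \<Rightarrow> 'a"
  where "tensor_mult_map A = tensor_lift (add_monoid A) (\<lambda>x y. x \<otimes>\<^bsub>A\<^esub> y)"

definition separability_element ::
    "('a, 'm) ring_scheme \<Rightarrow> 'a set \<Rightarrow> ('a \<times> 'a \<Rightarrow>\<^sub>0 int) set \<Rightarrow> bool"
  where "separability_element A B e \<longleftrightarrow>
    e \<in> carrier (tensor_group A B) \<and>
    (\<forall>a \<in> carrier A. tensor_lmult A B a e = tensor_rmult A B e a) \<and>
    tensor_mult_map A e = \<one>\<^bsub>A\<^esub>"


section \<open>Well-definedness\<close>

context
  fixes A :: "('a, 'm) ring_scheme" and B :: "'a set"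
  assumes ring_A: "ring A" and subring_B: "subring B A"
begin

interpretation A: ring A by (rule ring_A)

lemma B_subset: "B \<subseteq> carrier A"
  using subring_B by (meson subringE(1))

lemma tensor_relations_subset: "tensor_relations A B \<subseteq> carrier (pairs_group A)"
proof -
  have d: "c - d \<in> carrier (pairs_group A)"
    if "c \<in> carrier (pairs_group A)" "d \<in> carrier (pairs_group A)" for c d
    using that keys_diff[of c d] by auto
  show ?thesis
    unfolding tensor_relations_def
    using B_subset by (auto intro!: d simp del: carrier_free_Abelian_group_iff)
qed

lemma tensor_kernel_subgroup: "subgroup (tensor_kernel A B) (pairs_group A)"
  unfolding tensor_kernel_def
  by (rule group.generate_is_subgroup[OF group_free_Abelian_group tensor_relations_subset])

lemma tensor_kernel_normal: "tensor_kernel A B \<lhd> pairs_group A"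
  by (simp add: comm_group.normal_iff_subgroup[OF abelian_free_Abelian_group] tensor_kernel_subgroup)

lemma tensor_group_comm_group: "comm_group (tensor_group A B)"
  unfolding tensor_group_def
  by (rule comm_group.abelian_FactGroup[OF abelian_free_Abelian_group tensor_kernel_subgroup])

lemma pure_tensor_closed:
  "x \<in> carrier A \<Longrightarrow> y \<in> carrier A \<Longrightarrow> pure_tensor A B x y \<in> carrier (tensor_group A B)"
  unfolding pure_tensor_def tensor_group_def carrier_FactGroup by auto

lemma free_lift_hom:
  assumes G: "comm_group G"
    and f: "\<And>x y. x \<in> carrier A \<Longrightarrow> y \<in> carrier A \<Longrightarrow> f x y \<in> carrier G"
  defines "h \<equiv> pairs_lift G f"
  shows "h \<in> hom (pairs_group A) G"
    and "\<And>x y. x \<in> carrier A \<Longrightarrow> y \<in> carrier A \<Longrightarrow> h (frag_of (x, y)) = f x y"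
proof -
  interpret G: comm_group G by (rule G)
  have h_mono: "h c = (\<Otimes>\<^bsub>G\<^esub>p\<in>K. f (fst p) (snd p) [^]\<^bsub>G\<^esub> Poly_Mapping.lookup c p)"
    if "finite K" "Poly_Mapping.keys c \<subseteq> K" "K \<subseteq> carrier A \<times> carrier A" for c K
    unfolding h_def pairs_lift_def
    by (rule G.finprod_mono_neutral_cong_left)
       (use that f in \<open>auto simp: in_keys_iff intro!: G.int_pow_closed\<close>)
  show "h \<in> hom (pairs_group A) G"
  proof (rule homI)
    fix c assume "c \<in> carrier (pairs_group A)"
    then show "h c \<in> carrier G"
      unfolding h_def pairs_lift_def using f by (auto intro!: G.finprod_closed G.int_pow_closed)
  next
    fix c d assume c: "c \<in> carrier (pairs_group A)" and d: "d \<in> carrier (pairs_group A)"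
    let ?K = "Poly_Mapping.keys c \<union> Poly_Mapping.keys d"
    have K: "finite ?K" "?K \<subseteq> carrier A \<times> carrier A" using c d by auto
    have "h (c + d) = (\<Otimes>\<^bsub>G\<^esub>p\<in>?K. f (fst p) (snd p) [^]\<^bsub>G\<^esub> Poly_Mapping.lookup (c + d) p)"
      by (rule h_mono[OF K(1) keys_add K(2)])
    also have "\<dots> = (\<Otimes>\<^bsub>G\<^esub>p\<in>?K. f (fst p) (snd p) [^]\<^bsub>G\<^esub> Poly_Mapping.lookup c p
                        \<otimes>\<^bsub>G\<^esub> f (fst p) (snd p) [^]\<^bsub>G\<^esub> Poly_Mapping.lookup d p)"
    proof (rule G.finprod_cong')
      fix p assume "p \<in> ?K"
      then have "f (fst p) (snd p) \<in> carrier G" using K(2) f by auto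
      then show "f (fst p) (snd p) [^]\<^bsub>G\<^esub> Poly_Mapping.lookup (c + d) p
        = f (fst p) (snd p) [^]\<^bsub>G\<^esub> Poly_Mapping.lookup c p
          \<otimes>\<^bsub>G\<^esub> f (fst p) (snd p) [^]\<^bsub>G\<^esub> Poly_Mapping.lookup d p"
        by (simp add: Poly_Mapping.lookup_add G.int_pow_mult)
    qed (use K(2) f in \<open>auto intro!: G.int_pow_closed\<close>)
    also have "\<dots> = h c \<otimes>\<^bsub>G\<^esub> h d"
    proof -
      have "(\<lambda>p. f (fst p) (snd p) [^]\<^bsub>G\<^esub> Poly_Mapping.lookup e p) \<in> ?K \<rightarrow> carrier G" for e :: "'a \<times> 'a \<Rightarrow>\<^sub>0 int"
        using K(2) f by (intro Pi_I G.int_pow_closed) auto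
      then show ?thesis
        by (simp add: h_mono[OF K(1) Un_upper1 K(2)] h_mono[OF K(1) Un_upper2 K(2)]
            G.finprod_multf)
    qed
    finally show "h (c \<otimes>\<^bsub>pairs_group A\<^esub> d) = h c \<otimes>\<^bsub>G\<^esub> h d" by simp
  qed
  show "h (frag_of (x, y)) = f x y" if "x \<in> carrier A" "y \<in> carrier A" for x y
    unfolding h_def pairs_lift_def using that f by (simp add: keys_frag_of)
qed

lemma tensor_lift_coset:
  assumes G: "comm_group G" and f: "balanced_map A B G f" and c: "c \<in> carrier (pairs_group A)"
  shows "tensor_lift G f (tensor_kernel A B #>\<^bsub>pairs_group A\<^esub> c) =
    pairs_lift G f c"
proof -
  interpret G: comm_group G by (rule G)
  let ?F = "pairs_group A"
  define h where "h = pairs_lift G f"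
  have fcl: "f x y \<in> carrier G" if "x \<in> carrier A" "y \<in> carrier A" for x y
    using f that unfolding balanced_map_def by blast
  have hom: "h \<in> hom ?F G" and hf: "\<And>x y. x \<in> carrier A \<Longrightarrow> y \<in> carrier A \<Longrightarrow> h (frag_of (x, y)) = f x y"
    unfolding h_def using free_lift_hom[OF G, of f] fcl by auto
  interpret h: group_hom ?F G h
    using hom by (simp add: group_hom_def group_hom_axioms_def)
  have hdiff: "h (u - v) = h u \<otimes>\<^bsub>G\<^esub> inv\<^bsub>G\<^esub> h v" if "u \<in> carrier ?F" "v \<in> carrier ?F" for u v
  proof -
    have "h (u \<otimes>\<^bsub>?F\<^esub> inv\<^bsub>?F\<^esub> v) = h u \<otimes>\<^bsub>G\<^esub> inv\<^bsub>G\<^esub> h v"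
      using that group.inv_closed[OF group_free_Abelian_group that(2)]
      by (simp only: h.hom_mult h.hom_inv)
    then show ?thesis using that by simp
  qed
  have dcl: "u - v \<in> carrier ?F" if "u \<in> carrier ?F" "v \<in> carrier ?F" for u v
    using that keys_diff[of u v] by auto
  have frag_cl: "frag_of (x, y) \<in> carrier ?F" if "x \<in> carrier A" "y \<in> carrier A" for x y
    using that by simp
  have cancel: "p \<otimes>\<^bsub>G\<^esub> q \<otimes>\<^bsub>G\<^esub> inv\<^bsub>G\<^esub> p \<otimes>\<^bsub>G\<^esub> inv\<^bsub>G\<^esub> q = \<one>\<^bsub>G\<^esub>"
    if "p \<in> carrier G" "q \<in> carrier G" for p q
  proof -
    have "p \<otimes>\<^bsub>G\<^esub> q \<otimes>\<^bsub>G\<^esub> inv\<^bsub>G\<^esub> p = q"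
      using that by (metis G.inv_closed G.m_assoc G.m_comm G.r_inv G.r_one)
    then show ?thesis using that by simp
  qed
  have rel_l: "h (frag_of (x \<oplus>\<^bsub>A\<^esub> x', y) - frag_of (x, y) - frag_of (x', y)) = \<one>\<^bsub>G\<^esub>"
    if a: "x \<in> carrier A" "x' \<in> carrier A" "y \<in> carrier A" for x x' y
  proof -
    have "f (x \<oplus>\<^bsub>A\<^esub> x') y = f x y \<otimes>\<^bsub>G\<^esub> f x' y"
      using f a unfolding balanced_map_def by blast
    then show ?thesis
      using a cancel[OF fcl[OF a(1,3)] fcl[OF a(2,3)]]
      by (simp only: hdiff dcl frag_cl hf A.a_closed)
  qed
  have rel_r: "h (frag_of (x, y \<oplus>\<^bsub>A\<^esub> y') - frag_of (x, y) - frag_of (x, y')) = \<one>\<^bsub>G\<^esub>"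
    if a: "x \<in> carrier A" "y \<in> carrier A" "y' \<in> carrier A" for x y y'
  proof -
    have "f x (y \<oplus>\<^bsub>A\<^esub> y') = f x y \<otimes>\<^bsub>G\<^esub> f x y'"
      using f a unfolding balanced_map_def by blast
    then show ?thesis
      using a cancel[OF fcl[OF a(1,2)] fcl[OF a(1,3)]]
      by (simp only: hdiff dcl frag_cl hf A.a_closed)
  qed
  have rel_b: "h (frag_of (x \<otimes>\<^bsub>A\<^esub> b, y) - frag_of (x, b \<otimes>\<^bsub>A\<^esub> y)) = \<one>\<^bsub>G\<^esub>"
    if a: "x \<in> carrier A" "b \<in> B" "y \<in> carrier A" for x b y
  proof -
    have b: "b \<in> carrier A" using a(2) B_subset by blast
    have "f (x \<otimes>\<^bsub>A\<^esub> b) y = f x (b \<otimes>\<^bsub>A\<^esub> y)"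
      using f a unfolding balanced_map_def by blast
    then show ?thesis
      using a b G.r_inv[OF fcl[OF a(1) A.m_closed[OF b a(3)]]]
      by (simp only: hdiff frag_cl hf A.m_closed)
  qed
  have rel: "h r = \<one>\<^bsub>G\<^esub>" if "r \<in> tensor_relations A B" for r
    using that unfolding tensor_relations_def Un_iff mem_Collect_eq
    by (elim disjE exE conjE) (simp_all only: rel_l rel_r rel_b)
  have ker: "h k = \<one>\<^bsub>G\<^esub>" if "k \<in> tensor_kernel A B" for k
  proof -
    have "tensor_kernel A B \<subseteq> kernel ?F G h"
      unfolding tensor_kernel_def
      by (rule group.generate_subgroup_incl[OF group_free_Abelian_group _ h.subgroup_kernel])
         (use rel tensor_relations_subset in \<open>unfold kernel_def, blast\<close>)
    then show ?thesis using that by (auto simp: kernel_def)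
  qed
  have "h ` (tensor_kernel A B #>\<^bsub>?F\<^esub> c) = {h c}"
  proof -
    have "h d = h c" if d: "d \<in> tensor_kernel A B #>\<^bsub>?F\<^esub> c" for d
    proof -
      obtain k where k: "k \<in> tensor_kernel A B" "d = k \<otimes>\<^bsub>?F\<^esub> c"
        using d by (auto simp: r_coset_def)
      have "k \<in> carrier ?F" using k(1) tensor_kernel_subgroup by (meson subgroup.mem_carrier)
      then have "h d = h k \<otimes>\<^bsub>G\<^esub> h c" using k(2) c h.hom_mult by blast
      then show ?thesis using ker[OF k(1)] h.hom_closed[OF c] by simp
    qed
    moreover have "c \<in> tensor_kernel A B #>\<^bsub>?F\<^esub> c"
      using c tensor_kernel_subgroup by (rule group.rcos_self[OF group_free_Abelian_group])
    ultimately show ?thesis by blast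
  qed
  then show ?thesis by (simp add: tensor_lift_def h_def)
qed

lemma tensor_lift_pure:
  assumes G: "comm_group G" and f: "balanced_map A B G f"
    and xy: "x \<in> carrier A" "y \<in> carrier A"
  shows "tensor_lift G f (pure_tensor A B x y) = f x y"
proof -
  have "f x' y' \<in> carrier G" if "x' \<in> carrier A" "y' \<in> carrier A" for x' y'
    using f that unfolding balanced_map_def by blast
  then show ?thesis
    unfolding pure_tensor_def
    using xy by (simp add: tensor_lift_coset[OF G f] free_lift_hom(2)[OF G])
qed

lemma tensor_lift_hom:
  assumes G: "comm_group G" and f: "balanced_map A B G f"
  shows "tensor_lift G f \<in> hom (tensor_group A B) G"
proof -
  let ?F = "pairs_group A"
  have fcl: "f x y \<in> carrier G" if "x \<in> carrier A" "y \<in> carrier A" for x y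
    using f that unfolding balanced_map_def by blast
  have hom: "pairs_lift G f \<in> hom ?F G"
    using free_lift_hom(1)[OF G, of f] fcl by blast
  show ?thesis
  proof (rule homI)
    fix t assume "t \<in> carrier (tensor_group A B)"
    then obtain c where c: "c \<in> carrier ?F" "t = tensor_kernel A B #>\<^bsub>?F\<^esub> c"
      unfolding tensor_group_def carrier_FactGroup by blast
    show "tensor_lift G f t \<in> carrier G"
      using hom_in_carrier[OF hom c(1)] c by (simp add: tensor_lift_coset[OF G f c(1)])
  next
    fix t s assume "t \<in> carrier (tensor_group A B)" "s \<in> carrier (tensor_group A B)"
    then obtain c d where c: "c \<in> carrier ?F" "t = tensor_kernel A B #>\<^bsub>?F\<^esub> c"
      and d: "d \<in> carrier ?F" "s = tensor_kernel A B #>\<^bsub>?F\<^esub> d"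
      unfolding tensor_group_def carrier_FactGroup by blast
    have cd: "c \<otimes>\<^bsub>?F\<^esub> d \<in> carrier ?F"
      using group.subgroup_self[OF group_free_Abelian_group] c(1) d(1) by (rule subgroup.m_closed)
    have ts: "t \<otimes>\<^bsub>tensor_group A B\<^esub> s = tensor_kernel A B #>\<^bsub>?F\<^esub> (c \<otimes>\<^bsub>?F\<^esub> d)"
      unfolding tensor_group_def mult_FactGroup c(2) d(2)
      by (rule normal.rcos_sum[OF tensor_kernel_normal c(1) d(1)])
    show "tensor_lift G f (t \<otimes>\<^bsub>tensor_group A B\<^esub> s)
        = tensor_lift G f t \<otimes>\<^bsub>G\<^esub> tensor_lift G f s"
      using hom_mult[OF hom c(1) d(1)] c(2) d(2) ts
      by (simp only: tensor_lift_coset[OF G f cd] tensor_lift_coset[OF G f c(1)]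
        tensor_lift_coset[OF G f d(1)])
  qed
qed

lemma pure_tensor_balanced: "balanced_map A B (tensor_group A B) (pure_tensor A B)"
proof -
  let ?F = "pairs_group A"
  interpret N: normal "tensor_kernel A B" ?F by (rule tensor_kernel_normal)
  have eq: "tensor_kernel A B #>\<^bsub>?F\<^esub> c = tensor_kernel A B #>\<^bsub>?F\<^esub> d"
    if c: "c \<in> carrier ?F" and d: "d \<in> carrier ?F" and "c - d \<in> tensor_relations A B" for c d
  proof -
    have "c - d \<in> tensor_kernel A B"
      using that unfolding tensor_kernel_def by (blast intro: generate.incl)
    then have "c \<in> tensor_kernel A B #>\<^bsub>?F\<^esub> d"
      unfolding r_coset_def by force
    then show ?thesis
      using N.repr_independence d tensor_kernel_subgroup by blast
  qed
  have mult: "pure_tensor A B x y \<otimes>\<^bsub>tensor_group A B\<^esub> pure_tensor A B x' y'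
      = tensor_kernel A B #>\<^bsub>?F\<^esub> (frag_of (x, y) + frag_of (x', y'))"
    if "x \<in> carrier A" "y \<in> carrier A" "x' \<in> carrier A" "y' \<in> carrier A" for x y x' y'
    unfolding pure_tensor_def tensor_group_def mult_FactGroup
    using that by (subst N.rcos_sum) auto
  have plus: "c + d \<in> carrier ?F" if "c \<in> carrier ?F" "d \<in> carrier ?F" for c d
    using that keys_add[of c d] by auto
  show ?thesis
    unfolding balanced_map_def
  proof (intro conjI ballI)
    fix x x' y assume a: "x \<in> carrier A" "x' \<in> carrier A" "y \<in> carrier A"
    show "pure_tensor A B (x \<oplus>\<^bsub>A\<^esub> x') y
        = pure_tensor A B x y \<otimes>\<^bsub>tensor_group A B\<^esub> pure_tensor A B x' y"
      unfolding mult[OF a(1,3,2,3)] unfolding pure_tensor_def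
    proof (rule eq)
      show "frag_of (x \<oplus>\<^bsub>A\<^esub> x', y) - (frag_of (x, y) + frag_of (x', y)) \<in> tensor_relations A B"
        unfolding tensor_relations_def diff_diff_eq[symmetric] using a by blast
    qed (use a plus in \<open>auto simp del: carrier_free_Abelian_group_iff\<close>)
  next
    fix x y y' assume a: "x \<in> carrier A" "y \<in> carrier A" "y' \<in> carrier A"
    show "pure_tensor A B x (y \<oplus>\<^bsub>A\<^esub> y')
        = pure_tensor A B x y \<otimes>\<^bsub>tensor_group A B\<^esub> pure_tensor A B x y'"
      unfolding mult[OF a(1,2,1,3)] unfolding pure_tensor_def
    proof (rule eq)
      show "frag_of (x, y \<oplus>\<^bsub>A\<^esub> y') - (frag_of (x, y) + frag_of (x, y')) \<in> tensor_relations A B"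
        unfolding tensor_relations_def diff_diff_eq[symmetric] using a by blast
    qed (use a plus in \<open>auto simp del: carrier_free_Abelian_group_iff\<close>)
  next
    fix x b y assume a: "x \<in> carrier A" "b \<in> B" "y \<in> carrier A"
    show "pure_tensor A B (x \<otimes>\<^bsub>A\<^esub> b) y = pure_tensor A B x (b \<otimes>\<^bsub>A\<^esub> y)"
      unfolding pure_tensor_def
    proof (rule eq)
      show "frag_of (x \<otimes>\<^bsub>A\<^esub> b, y) - frag_of (x, b \<otimes>\<^bsub>A\<^esub> y) \<in> tensor_relations A B"
        unfolding tensor_relations_def using a by blast
    qed (use a B_subset in auto)
  qed (rule pure_tensor_closed)
qed

lemma lmult_balanced:
  assumes a: "a \<in> carrier A"
  shows "balanced_map A B (tensor_group A B) (\<lambda>x y. pure_tensor A B (a \<otimes>\<^bsub>A\<^esub> x) y)"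
  using pure_tensor_balanced a B_subset unfolding balanced_map_def
  by (simp add: A.r_distr subset_iff flip: A.m_assoc)

lemma rmult_balanced:
  assumes a: "a \<in> carrier A"
  shows "balanced_map A B (tensor_group A B) (\<lambda>x y. pure_tensor A B x (y \<otimes>\<^bsub>A\<^esub> a))"
  using pure_tensor_balanced a B_subset unfolding balanced_map_def
  by (simp add: A.l_distr subset_iff A.m_assoc)

lemma mult_balanced: "balanced_map A B (add_monoid A) (\<lambda>x y. x \<otimes>\<^bsub>A\<^esub> y)"
  using B_subset unfolding balanced_map_def
  by (simp add: A.l_distr A.r_distr subset_iff A.m_assoc)

lemma tensor_lmult_pure:
  "a \<in> carrier A \<Longrightarrow> x \<in> carrier A \<Longrightarrow> y \<in> carrier A \<Longrightarrow>
    tensor_lmult A B a (pure_tensor A B x y) = pure_tensor A B (a \<otimes>\<^bsub>A\<^esub> x) y"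
  unfolding tensor_lmult_def
  by (simp add: tensor_lift_pure[OF tensor_group_comm_group lmult_balanced])

lemma tensor_rmult_pure:
  "a \<in> carrier A \<Longrightarrow> x \<in> carrier A \<Longrightarrow> y \<in> carrier A \<Longrightarrow>
    tensor_rmult A B (pure_tensor A B x y) a = pure_tensor A B x (y \<otimes>\<^bsub>A\<^esub> a)"
  unfolding tensor_rmult_def
  by (simp add: tensor_lift_pure[OF tensor_group_comm_group rmult_balanced])

lemma tensor_mult_map_pure:
  "x \<in> carrier A \<Longrightarrow> y \<in> carrier A \<Longrightarrow>
    tensor_mult_map A (pure_tensor A B x y) = x \<otimes>\<^bsub>A\<^esub> y"
  unfolding tensor_mult_map_def
  by (simp add: tensor_lift_pure[OF A.a_comm_group mult_balanced])

lemma tensor_lmult_hom: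
  "a \<in> carrier A \<Longrightarrow> tensor_lmult A B a \<in> hom (tensor_group A B) (tensor_group A B)"
  unfolding tensor_lmult_def
  by (rule tensor_lift_hom[OF tensor_group_comm_group lmult_balanced])

lemma tensor_rmult_hom:
  "a \<in> carrier A \<Longrightarrow> (\<lambda>t. tensor_rmult A B t a) \<in> hom (tensor_group A B) (tensor_group A B)"
  unfolding tensor_rmult_def
  using tensor_lift_hom[OF tensor_group_comm_group rmult_balanced] by simp

lemma tensor_mult_map_hom: "tensor_mult_map A \<in> hom (tensor_group A B) (add_monoid A)"
  unfolding tensor_mult_map_def
  by (rule tensor_lift_hom[OF A.a_comm_group mult_balanced])

end

end

theory Submission
  imports Defs
begin

text \<open>
  For \<open>d\<close> in the centralizer \<open>A\<^sup>B\<close>, the tensor \<open>casimir d\<close> \<open>= \<Sum>\<^sub>i x\<^sub>i d \<otimes> y\<^sub>i\<close> satisfies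
  \<open>a t = t a\<close> for all \<open>a\<close> in \<open>A\<close>, and every such tensor \<open>t\<close> arises from exactly one \<open>d\<close>, namely
  its image under the contraction \<open>p \<otimes> q \<mapsto> p E(q)\<close> (lemmas \<open>casimir_invariant\<close>,
  \<open>invariant_is_casimir\<close>, \<open>contract_casimir\<close>). What makes this work is the expansion
  \<open>t = \<Sum>\<^sub>i contract (t x\<^sub>i) \<otimes> y\<^sub>i\<close> of an arbitrary tensor (\<open>tensor_expansion\<close>): a tensor is
  known as soon as the contractions of its right multiples are.

  Multiplication sends \<open>casimir d\<close> to \<open>trace d\<close> \<open>= \<Sum>\<^sub>i x\<^sub>i d y\<^sub>i\<close>, so separability elements
  correspond to the \<open>d\<close> in \<open>A\<^sup>B\<close> of trace one (\<open>separability_elements_eq\<close>). The tensor in the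
  theorem is \<open>casimir v\<close>, where \<open>v\<close> is the inverse of the index \<open>u\<close>. It remains to compare the
  center with \<open>A\<^sup>B\<close> through the trace (\<open>center_eq_centralizer_iff\<close>). The trace takes central
  values, and on a central \<open>z\<close> it is \<open>z u\<close>. Hence, if \<open>A\<^sup>B\<close> is the center, trace one means
  \<open>d = v\<close>. Conversely, adding the central element \<open>v (1 - trace d)\<close> to any \<open>d\<close> in \<open>A\<^sup>B\<close> gives an
  element of trace one; if \<open>v\<close> is the only one, \<open>d\<close> is a difference of central elements.
\<close>

section \<open>Additive maps on tensor products, and the center of a ring\<close>

lemma hom_finprod_commute:
  assumes "comm_group G" and "comm_group H" and "h \<in> hom G H" and "f \<in> I \<rightarrow> carrier G"
  shows "h (finprod G f I) = finprod H (\<lambda>i. h (f i)) I"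
proof -
  interpret G: comm_group G by fact
  interpret H: comm_group H by fact
  interpret h: group_hom G H h
    using assms(3) by unfold_locales
  show ?thesis
    using assms(4)
  proof (induction I rule: infinite_finite_induct)
    case (insert i I)
    then have "f \<in> I \<rightarrow> carrier G" and "f i \<in> carrier G" by auto
    then show ?case
      using insert by (simp add: Pi_def)
  qed simp_all
qed

lemma hom_pointwise_finprod:
  assumes "comm_group H" and "\<And>i. i \<in> I \<Longrightarrow> h i \<in> hom G H"
  shows "(\<lambda>t. finprod H (\<lambda>i. h i t) I) \<in> hom G H"
proof -
  interpret H: comm_group H by fact
  have cl: "(\<lambda>i. h i t) \<in> I \<rightarrow> carrier H" if "t \<in> carrier G" for t
    using assms(2) that by (auto dest: hom_in_carrier)
  show ?thesis
  proof (rule homI)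
    fix s t assume st: "s \<in> carrier G" "t \<in> carrier G"
    have "finprod H (\<lambda>i. h i (s \<otimes>\<^bsub>G\<^esub> t)) I = finprod H (\<lambda>i. h i s \<otimes>\<^bsub>H\<^esub> h i t) I"
      using st assms(2) cl by (intro H.finprod_cong') (auto simp: hom_mult dest: hom_in_carrier)
    then show "finprod H (\<lambda>i. h i (s \<otimes>\<^bsub>G\<^esub> t)) I
        = finprod H (\<lambda>i. h i s) I \<otimes>\<^bsub>H\<^esub> finprod H (\<lambda>i. h i t) I"
      using cl st by simp
  qed (rule H.finprod_closed[OF cl])
qed

text \<open>
  The composites of two homomorphisms with the projection from the free abelian group agree on the
  free generators. This is how every identity between additive maps on the tensor square is
  reduced to pure tensors below.
\<close>

lemma tensor_hom_ext:
  assumes "ring A" and "subring B A" and "comm_group G"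
    and h: "h \<in> hom (tensor_group A B) G" and k: "k \<in> hom (tensor_group A B) G"
    and pure: "\<And>p q. p \<in> carrier A \<Longrightarrow> q \<in> carrier A \<Longrightarrow>
      h (pure_tensor A B p q) = k (pure_tensor A B p q)"
    and t: "t \<in> carrier (tensor_group A B)"
  shows "h t = k t"
proof -
  let ?F = "pairs_group A" and ?K = "tensor_kernel A B"
  interpret G: comm_group G by fact
  interpret T: comm_group "tensor_group A B"
    by (rule tensor_group_comm_group) fact+
  interpret K: normal ?K ?F
    by (rule tensor_kernel_normal) fact+
  have proj: "(\<lambda>c. ?K #>\<^bsub>?F\<^esub> c) \<in> hom ?F (tensor_group A B)"
    unfolding tensor_group_def by (rule K.r_coset_hom_Mod)
  interpret h: group_hom ?F G "\<lambda>c. h (?K #>\<^bsub>?F\<^esub> c)"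
    using hom_compose[OF proj h] by unfold_locales (simp add: o_def)
  interpret k: group_hom ?F G "\<lambda>c. k (?K #>\<^bsub>?F\<^esub> c)"
    using hom_compose[OF proj k] by unfold_locales (simp add: o_def)
  obtain c where c: "c \<in> carrier ?F" "t = ?K #>\<^bsub>?F\<^esub> c"
    using t unfolding tensor_group_def carrier_FactGroup by blast
  from c(1) have "Poly_Mapping.keys c \<subseteq> carrier A \<times> carrier A" by simp
  then have "c \<in> carrier ?F \<and> h (?K #>\<^bsub>?F\<^esub> c) = k (?K #>\<^bsub>?F\<^esub> c)"
  proof (induction c rule: frag_induction)
    case zero
    then show ?case using h.hom_one k.hom_one by simp
  next
    case (one p)
    then show ?case
      using pure[of "fst p" "snd p"] by (auto simp: pure_tensor_def)
  next
    case (diff a b)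
    then have ab: "a \<in> carrier ?F" "b \<in> carrier ?F" by blast+
    have "a - b = a \<otimes>\<^bsub>?F\<^esub> inv\<^bsub>?F\<^esub> b" using ab by simp
    moreover have "a \<otimes>\<^bsub>?F\<^esub> inv\<^bsub>?F\<^esub> b \<in> carrier ?F"
      by (rule K.m_closed[OF ab(1) K.inv_closed[OF ab(2)]])
    ultimately show ?case
      using diff ab by (simp only: h.hom_mult k.hom_mult h.hom_inv k.hom_inv K.inv_closed)
  qed
  then show ?thesis using c(2) by simp
qed

lemma (in ring) subring_center: "subring (ring_center R) R"
proof (rule subringI)
  show "z \<otimes> w \<in> ring_center R" if zw: "z \<in> ring_center R" "w \<in> ring_center R" for z w
  proof -
    have z: "z \<in> carrier R" "\<And>a. a \<in> carrier R \<Longrightarrow> z \<otimes> a = a \<otimes> z"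
      and w: "w \<in> carrier R" "\<And>a. a \<in> carrier R \<Longrightarrow> w \<otimes> a = a \<otimes> w"
      using zw unfolding ring_center_def by auto
    have "z \<otimes> w \<otimes> a = a \<otimes> (z \<otimes> w)" if "a \<in> carrier R" for a
      using that z w by (metis m_assoc)
    then show ?thesis
      using z(1) w(1) by (simp add: ring_center_def)
  qed
qed (auto simp: ring_center_def l_distr r_distr l_minus r_minus)

section \<open>The tensor square of a Frobenius extension\<close>

locale frobenius_data = ring A
  for A :: "('a, 'm) ring_scheme" (structure) +
  fixes B :: "'a set" and E :: "'a \<Rightarrow> 'a" and n :: nat and x y :: "nat \<Rightarrow> 'a"
  assumes subring: "subring B A"
    and bimodule_hom: "bimodule_hom A B E"
    and dual_bases: "dual_bases A E n x y"
begin

abbreviation T where "T \<equiv> tensor_group A B"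
abbreviation pure where "pure \<equiv> pure_tensor A B"
abbreviation lmult where "lmult \<equiv> tensor_lmult A B"
abbreviation rmult where "rmult \<equiv> tensor_rmult A B"

text \<open>
  The map induced by \<open>id \<otimes> E\<close> under the identification \<open>A \<otimes>\<^sub>B B = A\<close>; it is well defined because
  \<open>E\<close> is left \<open>B\<close>-linear.
\<close>

definition contract :: "('a \<times> 'a \<Rightarrow>\<^sub>0 int) set \<Rightarrow> 'a"
  where "contract = tensor_lift (add_monoid A) (\<lambda>p q. p \<otimes> E q)"

definition casimir :: "'a \<Rightarrow> ('a \<times> 'a \<Rightarrow>\<^sub>0 int) set"
  where "casimir d = (\<Otimes>\<^bsub>T\<^esub>i\<in>{1..n}. pure (x i \<otimes> d) (y i))"

definition trace :: "'a \<Rightarrow> 'a"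
  where "trace d = (\<Oplus>i\<in>{1..n}. x i \<otimes> d \<otimes> y i)"

sublocale T: comm_group T
  by (rule tensor_group_comm_group[OF ring_axioms subring])

lemma B_carrier: "b \<in> B \<Longrightarrow> b \<in> carrier A"
  using subringE(1)[OF subring] by blast

lemma x_closed [simp]: "i \<in> {1..n} \<Longrightarrow> x i \<in> carrier A"
  and y_closed [simp]: "i \<in> {1..n} \<Longrightarrow> y i \<in> carrier A"
  using dual_bases unfolding dual_bases_def by blast+

lemma E_in_B: "a \<in> carrier A \<Longrightarrow> E a \<in> B"
  and E_add: "a \<in> carrier A \<Longrightarrow> a' \<in> carrier A \<Longrightarrow> E (a \<oplus> a') = E a \<oplus> E a'"
  and E_lmult: "b \<in> B \<Longrightarrow> a \<in> carrier A \<Longrightarrow> E (b \<otimes> a) = b \<otimes> E a"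
  and E_rmult: "a \<in> carrier A \<Longrightarrow> b \<in> B \<Longrightarrow> E (a \<otimes> b) = E a \<otimes> b"
  using bimodule_hom unfolding bimodule_hom_def by blast+

lemma E_closed [simp]: "a \<in> carrier A \<Longrightarrow> E a \<in> carrier A"
  using E_in_B B_carrier by blast

lemma dual_bases_left: "a \<in> carrier A \<Longrightarrow> (\<Oplus>i\<in>{1..n}. E (a \<otimes> x i) \<otimes> y i) = a"
  and dual_bases_right: "a \<in> carrier A \<Longrightarrow> (\<Oplus>i\<in>{1..n}. x i \<otimes> E (y i \<otimes> a)) = a"
  using dual_bases unfolding dual_bases_def by metis+

lemma centralizer_closed: "d \<in> ring_centralizer A B \<Longrightarrow> d \<in> carrier A"
  and centralizer_commute: "d \<in> ring_centralizer A B \<Longrightarrow> b \<in> B \<Longrightarrow> d \<otimes> b = b \<otimes> d"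
  unfolding ring_centralizer_def by blast+

lemma center_subset_centralizer: "ring_center A \<subseteq> ring_centralizer A B"
  unfolding ring_center_def ring_centralizer_def using B_carrier by blast

lemmas pure_closed [simp] = pure_tensor_closed[OF ring_axioms subring]
lemmas lmult_pure [simp] = tensor_lmult_pure[OF ring_axioms subring]
lemmas rmult_pure [simp] = tensor_rmult_pure[OF ring_axioms subring]
lemmas lmult_hom = tensor_lmult_hom[OF ring_axioms subring]
lemmas rmult_hom = tensor_rmult_hom[OF ring_axioms subring]
lemmas mult_map_pure [simp] = tensor_mult_map_pure[OF ring_axioms subring]
lemmas mult_map_hom = tensor_mult_map_hom[OF ring_axioms subring]
lemmas ext_on_pure = tensor_hom_ext[OF ring_axioms subring]

lemma rmult_closed [simp]: "a \<in> carrier A \<Longrightarrow> t \<in> carrier T \<Longrightarrow> rmult t a \<in> carrier T"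
  using rmult_hom by (blast dest: hom_in_carrier)

lemma pure_rmult_base: "p \<in> carrier A \<Longrightarrow> b \<in> B \<Longrightarrow> q \<in> carrier A \<Longrightarrow> pure (p \<otimes> b) q = pure p (b \<otimes> q)"
  and pure_left_hom: "q \<in> carrier A \<Longrightarrow> (\<lambda>p. pure p q) \<in> hom (add_monoid A) T"
  and pure_right_hom: "p \<in> carrier A \<Longrightarrow> (\<lambda>q. pure p q) \<in> hom (add_monoid A) T"
  using pure_tensor_balanced[OF ring_axioms subring] unfolding balanced_map_def
  by (auto intro!: homI)

lemma contract_balanced: "balanced_map A B (add_monoid A) (\<lambda>p q. p \<otimes> E q)"
  unfolding balanced_map_def
  by (auto simp: l_distr r_distr E_add E_lmult m_assoc B_carrier)

lemma contract_hom: "contract \<in> hom T (add_monoid A)"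
  unfolding contract_def by (rule tensor_lift_hom[OF ring_axioms subring a_comm_group contract_balanced])

lemma contract_pure [simp]:
  "p \<in> carrier A \<Longrightarrow> q \<in> carrier A \<Longrightarrow> contract (pure p q) = p \<otimes> E q"
  unfolding contract_def
  by (rule tensor_lift_pure[OF ring_axioms subring a_comm_group contract_balanced])

lemma contract_closed [simp]: "t \<in> carrier T \<Longrightarrow> contract t \<in> carrier A"
  using hom_in_carrier[OF contract_hom] by simp

lemma additive_finsum:
  assumes "comm_group H" and "h \<in> hom (add_monoid A) H" and "f \<in> I \<rightarrow> carrier A"
  shows "h (\<Oplus>i\<in>I. f i) = finprod H (\<lambda>i. h (f i)) I"
  using hom_finprod_commute[OF a_comm_group assms(1,2)] assms(3) by (simp add: finsum_def)

lemma hom_finsum: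
  assumes "h \<in> hom T (add_monoid A)" and "f \<in> I \<rightarrow> carrier T"
  shows "h (\<Otimes>\<^bsub>T\<^esub>i\<in>I. f i) = (\<Oplus>i\<in>I. h (f i))"
  using hom_finprod_commute[OF T.comm_group_axioms a_comm_group assms] by (simp add: finsum_def)

lemma lmult_additive: "a \<in> carrier A \<Longrightarrow> (\<lambda>p. a \<otimes> p) \<in> hom (add_monoid A) (add_monoid A)"
  and rmult_additive: "a \<in> carrier A \<Longrightarrow> (\<lambda>p. p \<otimes> a) \<in> hom (add_monoid A) (add_monoid A)"
  by (auto intro!: homI simp: l_distr r_distr)

lemma mult_finsum:
  assumes "a \<in> carrier A" and "f \<in> I \<rightarrow> carrier A"
  shows "a \<otimes> (\<Oplus>i\<in>I. f i) = (\<Oplus>i\<in>I. a \<otimes> f i)"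
    and "(\<Oplus>i\<in>I. f i) \<otimes> a = (\<Oplus>i\<in>I. f i \<otimes> a)"
  using additive_finsum[OF a_comm_group lmult_additive[OF assms(1)] assms(2)]
    additive_finsum[OF a_comm_group rmult_additive[OF assms(1)] assms(2)]
  by (simp_all add: finsum_def)

lemma rmult_rmult:
  assumes "a \<in> carrier A" and "c \<in> carrier A" and "t \<in> carrier T"
  shows "rmult (rmult t a) c = rmult t (a \<otimes> c)"
  by (rule ext_on_pure[OF T.comm_group_axioms
      hom_compose[OF rmult_hom[OF assms(1)] rmult_hom[OF assms(2)], unfolded o_def]
      rmult_hom[OF m_closed[OF assms(1,2)]] _ assms(3)])
    (use assms in \<open>simp add: m_assoc\<close>)

lemma rmult_one [simp]:
  assumes "t \<in> carrier T"
  shows "rmult t \<one> = t"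
  by (rule ext_on_pure[OF T.comm_group_axioms rmult_hom[OF one_closed] _ _ assms])
    (auto intro!: homI)

lemma contract_lmult:
  assumes "a \<in> carrier A" and "t \<in> carrier T"
  shows "contract (lmult a t) = a \<otimes> contract t"
  by (rule ext_on_pure[OF a_comm_group
      hom_compose[OF lmult_hom[OF assms(1)] contract_hom, unfolded o_def]
      hom_compose[OF contract_hom lmult_additive[OF assms(1)], unfolded o_def] _ assms(2)])
    (use assms in \<open>simp add: m_assoc\<close>)

lemma contract_rmult_base:
  assumes "b \<in> B" and "t \<in> carrier T"
  shows "contract (rmult t b) = contract t \<otimes> b"
  by (rule ext_on_pure[OF a_comm_group
      hom_compose[OF rmult_hom contract_hom, unfolded o_def]
      hom_compose[OF contract_hom rmult_additive, unfolded o_def] _ assms(2)])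
    (use assms in \<open>simp_all add: m_assoc E_rmult B_carrier\<close>)

lemma mult_map_lmult:
  assumes "a \<in> carrier A" and "t \<in> carrier T"
  shows "tensor_mult_map A (lmult a t) = a \<otimes> tensor_mult_map A t"
  by (rule ext_on_pure[OF a_comm_group
      hom_compose[OF lmult_hom[OF assms(1)] mult_map_hom, unfolded o_def]
      hom_compose[OF mult_map_hom lmult_additive[OF assms(1)], unfolded o_def] _ assms(2)])
    (use assms in \<open>simp add: m_assoc\<close>)

lemma mult_map_rmult:
  assumes "a \<in> carrier A" and "t \<in> carrier T"
  shows "tensor_mult_map A (rmult t a) = tensor_mult_map A t \<otimes> a"
  by (rule ext_on_pure[OF a_comm_group
      hom_compose[OF rmult_hom[OF assms(1)] mult_map_hom, unfolded o_def]
      hom_compose[OF mult_map_hom rmult_additive[OF assms(1)], unfolded o_def] _ assms(2)])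
    (use assms in \<open>simp add: m_assoc\<close>)

text \<open>
  On a pure tensor this is the dual basis identity for the right factor,
  \<open>p \<otimes> q = \<Sum>\<^sub>i p \<otimes> E(q x\<^sub>i) y\<^sub>i\<close>, after moving the scalars \<open>E(q x\<^sub>i)\<close> of \<open>B\<close> across the tensor
  sign; both sides are additive in \<open>t\<close>.
\<close>

lemma tensor_expansion:
  assumes "t \<in> carrier T"
  shows "t = (\<Otimes>\<^bsub>T\<^esub>i\<in>{1..n}. pure (contract (rmult t (x i))) (y i))"
proof (rule ext_on_pure[OF T.comm_group_axioms _ _ _ assms])
  show "(\<lambda>t. t) \<in> hom T T" by (auto intro!: homI)
  show "(\<lambda>t. \<Otimes>\<^bsub>T\<^esub>i\<in>{1..n}. pure (contract (rmult t (x i))) (y i)) \<in> hom T T"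
    by (rule hom_pointwise_finprod[OF T.comm_group_axioms])
      (use hom_compose[OF hom_compose[OF rmult_hom contract_hom] pure_left_hom]
        in \<open>simp add: o_def\<close>)
next
  fix p q assume pq: "p \<in> carrier A" "q \<in> carrier A"
  have "pure p q = pure p (\<Oplus>i\<in>{1..n}. E (q \<otimes> x i) \<otimes> y i)"
    using dual_bases_left[OF pq(2)] by (simp del: One_nat_def)
  also have "\<dots> = (\<Otimes>\<^bsub>T\<^esub>i\<in>{1..n}. pure p (E (q \<otimes> x i) \<otimes> y i))"
    using pq by (intro additive_finsum[OF T.comm_group_axioms pure_right_hom]) auto
  also have "\<dots> = (\<Otimes>\<^bsub>T\<^esub>i\<in>{1..n}. pure (contract (rmult (pure p q) (x i))) (y i))"
    using pq by (intro T.finprod_cong') (auto simp: E_in_B pure_rmult_base)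
  finally show "pure p q = (\<Otimes>\<^bsub>T\<^esub>i\<in>{1..n}. pure (contract (rmult (pure p q) (x i))) (y i))" .
qed

section \<open>Casimir elements correspond to the centralizer\<close>

lemma casimir_closed [simp]: "d \<in> carrier A \<Longrightarrow> casimir d \<in> carrier T"
  unfolding casimir_def by (intro T.finprod_closed) auto

lemma trace_closed [simp]: "d \<in> carrier A \<Longrightarrow> trace d \<in> carrier A"
  unfolding trace_def by (intro finsum_closed) auto

lemma mult_map_casimir: "d \<in> carrier A \<Longrightarrow> tensor_mult_map A (casimir d) = trace d"
  unfolding casimir_def trace_def
  by (subst hom_finsum[OF mult_map_hom]) (auto intro!: finsum_cong')

lemma lmult_casimir:
  assumes "a \<in> carrier A" and "d \<in> carrier A"
  shows "lmult a (casimir d) = (\<Otimes>\<^bsub>T\<^esub>i\<in>{1..n}. pure (a \<otimes> x i \<otimes> d) (y i))"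
proof -
  have "lmult a (casimir d) = (\<Otimes>\<^bsub>T\<^esub>i\<in>{1..n}. lmult a (pure (x i \<otimes> d) (y i)))"
    unfolding casimir_def using assms
    by (intro hom_finprod_commute[OF T.comm_group_axioms T.comm_group_axioms lmult_hom]) auto
  also have "\<dots> = (\<Otimes>\<^bsub>T\<^esub>i\<in>{1..n}. pure (a \<otimes> x i \<otimes> d) (y i))"
    using assms by (intro T.finprod_cong') (auto simp: m_assoc)
  finally show ?thesis .
qed

lemma casimir_one: "casimir \<one> = (\<Otimes>\<^bsub>T\<^esub>i\<in>{1..n}. pure (x i) (y i))"
  unfolding casimir_def by (rule T.finprod_cong') auto

lemma lmult_casimir_one:
  assumes "z \<in> ring_center A"
  shows "lmult z (casimir \<one>) = casimir z"
proof -
  have z: "z \<in> carrier A" "\<And>a. a \<in> carrier A \<Longrightarrow> z \<otimes> a = a \<otimes> z"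
    using assms unfolding ring_center_def by auto
  show ?thesis
    unfolding lmult_casimir[OF z(1) one_closed] casimir_def[of z]
    using z by (intro T.finprod_cong') auto
qed

text \<open>
  Since \<open>d\<close> commutes with \<open>E(y\<^sub>i c)\<close> in \<open>B\<close>, it can be pulled out on the right of
  \<open>\<Sum>\<^sub>i x\<^sub>i d E(y\<^sub>i c)\<close>, which leaves the other dual basis identity. All contractions of right
  multiples are computed at once because \<open>tensor_expansion\<close> needs them all.
\<close>

lemma contract_rmult_casimir:
  assumes d: "d \<in> ring_centralizer A B" and c: "c \<in> carrier A"
  shows "contract (rmult (casimir d) c) = c \<otimes> d"
proof -
  note dc = centralizer_closed[OF d]
  have "contract (rmult (casimir d) c) = (\<Oplus>i\<in>{1..n}. contract (rmult (pure (x i \<otimes> d) (y i)) c))"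
    unfolding casimir_def
    by (rule hom_finsum[OF hom_compose[OF rmult_hom[OF c] contract_hom, unfolded o_def]])
      (use dc in auto)
  also have "\<dots> = (\<Oplus>i\<in>{1..n}. x i \<otimes> E (y i \<otimes> c) \<otimes> d)"
    using dc c by (intro finsum_cong') (auto simp: m_assoc centralizer_commute[OF d] E_in_B)
  also have "\<dots> = c \<otimes> d"
    using dc c by (subst mult_finsum(2)[symmetric]) (use dual_bases_right[OF c] in auto)
  finally show ?thesis .
qed

lemma contract_casimir: "d \<in> ring_centralizer A B \<Longrightarrow> contract (casimir d) = d"
  using contract_rmult_casimir[of d \<one>] by (simp add: centralizer_closed)

text \<open>
  By \<open>contract_rmult_casimir\<close> the coefficients in the expansion of \<open>casimir d\<close> times \<open>a\<close> are
  \<open>a x\<^sub>i d\<close>, and these are the left factors of \<open>a\<close> times \<open>casimir d\<close>.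
\<close>

lemma casimir_invariant:
  assumes d: "d \<in> ring_centralizer A B" and a: "a \<in> carrier A"
  shows "lmult a (casimir d) = rmult (casimir d) a"
proof -
  note dc = centralizer_closed[OF d]
  have "rmult (casimir d) a
      = (\<Otimes>\<^bsub>T\<^esub>i\<in>{1..n}. pure (contract (rmult (rmult (casimir d) a) (x i))) (y i))"
    using dc a by (intro tensor_expansion) simp
  also have "\<dots> = (\<Otimes>\<^bsub>T\<^esub>i\<in>{1..n}. pure (a \<otimes> x i \<otimes> d) (y i))"
    using dc a by (intro T.finprod_cong') (auto simp: rmult_rmult contract_rmult_casimir[OF d])
  also have "\<dots> = lmult a (casimir d)"
    using dc a by (simp add: lmult_casimir)
  finally show ?thesis by simp
qed

text \<open>
  Contraction is left \<open>A\<close>-linear and right \<open>B\<close>-linear. Comparing the contractions of \<open>b t\<close> and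
  \<open>t b\<close> puts \<open>contract t\<close> into the centralizer, and invariance turns the coefficient
  \<open>contract (t x\<^sub>i)\<close> of the expansion into \<open>x\<^sub>i contract t\<close>.
\<close>

lemma invariant_is_casimir:
  assumes t: "t \<in> carrier T" and inv: "\<And>a. a \<in> carrier A \<Longrightarrow> lmult a t = rmult t a"
  shows "contract t \<in> ring_centralizer A B" and "t = casimir (contract t)"
proof -
  have "contract t \<otimes> b = b \<otimes> contract t" if "b \<in> B" for b
    using that t B_carrier[OF that] inv[of b] contract_lmult[of b t] contract_rmult_base[of b t]
    by simp
  then show "contract t \<in> ring_centralizer A B"
    using t unfolding ring_centralizer_def by simp
  have "t = (\<Otimes>\<^bsub>T\<^esub>i\<in>{1..n}. pure (contract (rmult t (x i))) (y i))"
    by (rule tensor_expansion[OF t])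
  also have "\<dots> = casimir (contract t)"
    unfolding casimir_def
    using t by (intro T.finprod_cong') (auto simp: contract_lmult simp flip: inv)
  finally show "t = casimir (contract t)" .
qed

lemma separability_elements_eq:
  "{e. separability_element A B e} = casimir ` {d \<in> ring_centralizer A B. trace d = \<one>}"
proof (intro equalityI subsetI)
  fix e assume "e \<in> {e. separability_element A B e}"
  then have e: "e \<in> carrier T" "\<And>a. a \<in> carrier A \<Longrightarrow> lmult a e = rmult e a"
      "tensor_mult_map A e = \<one>"
    unfolding separability_element_def by auto
  note d = invariant_is_casimir[OF e(1,2)]
  have "trace (contract e) = \<one>"
    using mult_map_casimir[OF contract_closed[OF e(1)]] d(2) e(3) by simp
  then show "e \<in> casimir ` {d \<in> ring_centralizer A B. trace d = \<one>}"
    using d by blast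
next
  fix e assume "e \<in> casimir ` {d \<in> ring_centralizer A B. trace d = \<one>}"
  then show "e \<in> {e. separability_element A B e}"
    by (auto simp: separability_element_def centralizer_closed casimir_invariant mult_map_casimir)
qed

lemma casimir_inj: "inj_on casimir (ring_centralizer A B)"
  by (rule inj_on_inverseI[of _ contract]) (rule contract_casimir)

section \<open>The trace and the index\<close>

lemma trace_add:
  assumes "d \<in> carrier A" and "d' \<in> carrier A"
  shows "trace (d \<oplus> d') = trace d \<oplus> trace d'"
proof -
  have "trace (d \<oplus> d') = (\<Oplus>i\<in>{1..n}. x i \<otimes> d \<otimes> y i \<oplus> x i \<otimes> d' \<otimes> y i)"
    unfolding trace_def using assms by (intro finsum_cong') (auto simp: r_distr l_distr)
  also have "\<dots> = trace d \<oplus> trace d'"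
    unfolding trace_def using assms by (intro finsum_addf) auto
  finally show ?thesis .
qed

lemma trace_central:
  assumes "z \<in> ring_center A"
  shows "trace z = z \<otimes> frobenius_index A n x y"
proof -
  have z: "z \<in> carrier A" "\<And>a. a \<in> carrier A \<Longrightarrow> a \<otimes> z = z \<otimes> a"
    using assms unfolding ring_center_def by auto
  show ?thesis
    unfolding trace_def frobenius_index_def using z
    by (subst mult_finsum(1)) (auto intro!: finsum_cong' simp: m_assoc)
qed

text \<open>
  The trace is the image of an invariant tensor under the multiplication map, which is a
  homomorphism of \<open>A\<close>-\<open>A\<close>-bimodules.
\<close>

lemma trace_in_center:
  assumes "d \<in> ring_centralizer A B"
  shows "trace d \<in> ring_center A"
proof -
  note dc = centralizer_closed[OF assms]
  have "trace d \<otimes> a = a \<otimes> trace d" if a: "a \<in> carrier A" for a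
    using mult_map_lmult[OF a casimir_closed[OF dc]] mult_map_rmult[OF a casimir_closed[OF dc]]
    by (simp add: casimir_invariant[OF assms a] mult_map_casimir[OF dc])
  then show ?thesis using dc unfolding ring_center_def by simp
qed

lemma centralizer_add:
  assumes "d \<in> ring_centralizer A B" and "d' \<in> ring_centralizer A B"
  shows "d \<oplus> d' \<in> ring_centralizer A B"
  using assms B_carrier unfolding ring_centralizer_def by (simp add: l_distr r_distr)

text \<open>
  If the trace is \<open>z u\<close> on the whole centralizer, then \<open>v\<close> is visibly the only solution of
  \<open>trace d = \<one>\<close>. For the converse every \<open>d\<close> in the centralizer is moved by a central element to
  trace one, where uniqueness identifies it with the central \<open>v\<close>.
\<close>

lemma center_eq_centralizer_iff:
  assumes v: "v \<in> ring_center A" and vu: "v \<otimes> frobenius_index A n x y = \<one>"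
  shows "ring_center A = ring_centralizer A B \<longleftrightarrow>
    {d \<in> ring_centralizer A B. trace d = \<one>} = {v}"
proof
  let ?u = "frobenius_index A n x y"
  have vc: "v \<in> carrier A" and vcomm: "\<And>a. a \<in> carrier A \<Longrightarrow> v \<otimes> a = a \<otimes> v"
    using v unfolding ring_center_def by auto
  have uc: "?u \<in> carrier A"
    unfolding frobenius_index_def by (intro finsum_closed) auto
  have uv: "?u \<otimes> v = \<one>" using vu vcomm[OF uc] by simp
  show "{d \<in> ring_centralizer A B. trace d = \<one>} = {v}" if eq: "ring_center A = ring_centralizer A B"
  proof (intro equalityI subsetI)
    fix d assume "d \<in> {d \<in> ring_centralizer A B. trace d = \<one>}"
    then have d: "d \<in> ring_center A" "trace d = \<one>" using eq by auto
    then have "d \<otimes> ?u = \<one>" and dc: "d \<in> carrier A"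
      using trace_central unfolding ring_center_def by auto
    then have "d = v"
      using vc uc uv by (metis l_one m_assoc r_one)
    then show "d \<in> {v}" by simp
  next
    fix d assume "d \<in> {v}"
    then show "d \<in> {d \<in> ring_centralizer A B. trace d = \<one>}"
      using v eq trace_central[OF v] vu by simp
  qed
  show "ring_center A = ring_centralizer A B"
    if uniq: "{d \<in> ring_centralizer A B. trace d = \<one>} = {v}"
  proof (intro equalityI center_subset_centralizer subsetI)
    fix d assume d: "d \<in> ring_centralizer A B"
    note dc = centralizer_closed[OF d]
    \<comment> \<open>the central correction that raises the trace of \<open>d\<close> to one\<close>
    define z where "z = v \<otimes> (\<one> \<oplus> \<ominus> trace d)"
    have tz: "\<one> \<oplus> \<ominus> trace d \<in> carrier A" using dc by simp
    have z: "z \<in> ring_center A"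
      unfolding z_def using v trace_in_center[OF d] by (intro subringE[OF subring_center])
    have zc: "z \<in> carrier A" unfolding z_def using vc tz by simp
    have "trace z = \<one> \<oplus> \<ominus> trace d"
    proof -
      have "trace z = (\<one> \<oplus> \<ominus> trace d) \<otimes> (v \<otimes> ?u)"
        unfolding trace_central[OF z] unfolding z_def vcomm[OF tz] using vc uc tz
        by (simp add: m_assoc)
      then show ?thesis using vu tz by simp
    qed
    then have "trace (d \<oplus> z) = \<one>"
      using dc zc tz by (simp add: trace_add a_lcomm r_neg)
    moreover have "d \<oplus> z \<in> ring_centralizer A B"
      using d z center_subset_centralizer by (intro centralizer_add) auto
    ultimately have "d \<oplus> z = v" using uniq by blast
    then have "d = v \<oplus> \<ominus> z" using dc zc by (metis a_assoc a_inv_closed r_neg r_zero)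
    then show "d \<in> ring_center A" using v z by (simp add: subringE[OF subring_center])
  qed
qed

end

theorem theorem4p1:
  fixes A :: "('a, 'm) ring_scheme" and B :: "'a set" and E :: "'a \<Rightarrow> 'a"
    and n :: nat and x y :: "nat \<Rightarrow> 'a"
  assumes "frobenius_extension A B E"
    and "dual_bases A E n x y"
    and "frobenius_index A n x y \<in> Units (A\<lparr>carrier := ring_center A\<rparr>)"
  shows "ring_center A = ring_centralizer A B \<longleftrightarrow>
    {e. separability_element A B e} =
      {tensor_lmult A B (inv\<^bsub>A\<^esub> (frobenius_index A n x y))
         (\<Otimes>\<^bsub>tensor_group A B\<^esub>i\<in>{1..n}. pure_tensor A B (x i) (y i))}"
proof -
  interpret ring A using assms(1) unfolding frobenius_extension_def by blast
  interpret frobenius_data A B E n x y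
    using assms(1,2) ring_axioms
    unfolding frobenius_extension_def frobenius_data_def frobenius_data_axioms_def by blast
  let ?u = "frobenius_index A n x y"
  obtain v where u: "?u \<in> ring_center A" and v: "v \<in> ring_center A"
    and uv: "?u \<otimes>\<^bsub>A\<^esub> v = \<one>\<^bsub>A\<^esub>" and vu: "v \<otimes>\<^bsub>A\<^esub> ?u = \<one>\<^bsub>A\<^esub>"
    using assms(3) unfolding Units_def by auto
  have uc: "?u \<in> carrier A" and vc: "v \<in> carrier A"
    using u v unfolding ring_center_def by auto
  have inv: "inv\<^bsub>A\<^esub> ?u = v"
    using inv_unique'[OF uc vc uv vu] by simp
  have cas: "tensor_lmult A B (inv\<^bsub>A\<^esub> ?u) (\<Otimes>\<^bsub>T\<^esub>i\<in>{1..n}. pure (x i) (y i)) = casimir v"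
    unfolding inv casimir_one[symmetric] by (rule lmult_casimir_one[OF v])
  let ?D = "{d \<in> ring_centralizer A B. trace d = \<one>\<^bsub>A\<^esub>}"
  have "casimir ` ?D = casimir ` {v} \<longleftrightarrow> ?D = {v}"
    using v center_subset_centralizer by (intro inj_on_image_eq_iff[OF casimir_inj]) auto
  then show ?thesis
    unfolding center_eq_centralizer_iff[OF v vu] separability_elements_eq cas by simp
qed

end
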